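(* Let $I$ be a positive integer, let $\mathcal{P}=\mathcal{P}_1\times\dots\times\mathcal{P}_I$ where each $\mathcal{P}_i$ is a finite subset of $\mathbb{R}_+$, and let $\mathbf{u}=(\boldsymbol{\alpha},\boldsymbol{\beta},\boldsymbol{\gamma})$ with $\boldsymbol{\alpha},\boldsymbol{\beta}\in\mathbb{R}^I$ and $\boldsymbol{\gamma}=(\gamma_{i,j})_{i\ne j}\in\mathbb{R}^{I(I-1)}$. Let $$R(\mathbf{p},\mathbf{u}) = \sum_{i=1}^I p_i\, e^{\alpha_i-\beta_i \log p_i+\sum_{j\ne i}\gamma_{i,j}\log p_j}$$ be the log-log revenue function. Then $\max_{\mathbf{p}\in\mathcal{P}} \log R(\mathbf{p},\mathbf{u})$ equals the optimal objective value of the following mixed-integer convex program in the variables $\mu_i$ ($i\in[I]$), $w_{i,j,t}$ ($i,j\in[I]$, $t\in\mathcal{P}_j$), $x_{i,t}$ ($i\in[I]$, $t\in\mathcal{P}_i$): $$\text{maximize}\quad \sum_{i=1}^I \mu_i\alpha_i + \sum_{i=1}^I\sum_{t\in\mathcal{P}_i} \log t\cdot w_{i,i,t} - \sum_{i=1}^I \beta_i\sum_{t\in\mathcal{P}_i} \log t\cdot w_{i,i,t} + \sum_{i=1}^I\sum_{j\ne i}\gamma_{i,j}\sum_{t\in\mathcal{P}_j} \log t\cdot w_{i,j,t} - \sum_{i=1}^I \mu_i\log\mu_i$$ subject to $\sum_{t\in\mathcal{P}_j} w_{i,j,t}=\mu_i$ for all $i,j\in[I]$; $\sum_{i=1}^I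 w_{i,j,t}=x_{j,t}$ for all $j\in[I]$, $t\in\mathcal{P}_j$; $\sum_{i=1}^I\mu_i=1$; $\sum_{t\in\mathcal{P}_i}x_{i,t}=1$ for all $i\in[I]$; $w_{i,j,t}\ge 0$ for all $i,j\in[I]$, $t\in\mathcal{P}_j$; $x_{i,t}\in\{0,1\}$ for all $i\in[I]$, $t\in\mathcal{P}_i$; $\mu_i\ge0$ for all $i\in[I]$.
   Context: $[I]=\{1,\dots,I\}$, and $\mathbb{R}_+$ is the set of nonnegative real numbers. In the entropy term, $0\log 0$ is read as $0$, as usual. The set $\mathcal{P}$ is the set of feasible price vectors for $I$ products, and $x_{i,t}=1$ indicates that product $i$ is given price $t$.
   Formalization: Each price set is additionally assumed not to contain 0, because log p_i and log t in the revenue function and the program are undefined at price 0. *)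

theory Defs
  imports "HOL-Analysis.Analysis"
begin

text \<open>
  Products are indexed by \<open>{1..I}\<close>. Vectors are functions of which only the values on the relevant
  index sets are used; in particular the diagonal of \<open>\<gamma>\<close> never occurs.
\<close>

definition price_vectors :: "nat \<Rightarrow> (nat \<Rightarrow> real set) \<Rightarrow> (nat \<Rightarrow> real) set" where
  "price_vectors I P = PiE {1..I} P"

definition revenue ::
  "nat \<Rightarrow> (nat \<Rightarrow> real) \<Rightarrow> (nat \<Rightarrow> real) \<Rightarrow> (nat \<Rightarrow> nat \<Rightarrow> real) \<Rightarrow> (nat \<Rightarrow> real) \<Rightarrow> real" where
  "revenue I \<alpha> \<beta> \<gamma> p =
     (\<Sum>i\<in>{1..I}. p i * exp (\<alpha> i - \<beta> i * ln (p i) + (\<Sum>j\<in>{1..I} - {i}. \<gamma> i j * ln (p j))))"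

definition micp_feasible ::
  "nat \<Rightarrow> (nat \<Rightarrow> real set) \<Rightarrow>
   ((nat \<Rightarrow> real) \<times> (nat \<Rightarrow> nat \<Rightarrow> real \<Rightarrow> real) \<times> (nat \<Rightarrow> real \<Rightarrow> real)) set" where
  "micp_feasible I P = {(\<mu>, w, x).
     (\<forall>i\<in>{1..I}. \<forall>j\<in>{1..I}. (\<Sum>t\<in>P j. w i j t) = \<mu> i) \<and>
     (\<forall>j\<in>{1..I}. \<forall>t\<in>P j. (\<Sum>i\<in>{1..I}. w i j t) = x j t) \<and>
     (\<Sum>i\<in>{1..I}. \<mu> i) = 1 \<and>
     (\<forall>i\<in>{1..I}. (\<Sum>t\<in>P i. x i t) = 1) \<and>
     (\<forall>i\<in>{1..I}. \<forall>j\<in>{1..I}. \<forall>t\<in>P j. 0 \<le> w i j t) \<and>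
     (\<forall>i\<in>{1..I}. \<forall>t\<in>P i. x i t \<in> {0, 1}) \<and>
     (\<forall>i\<in>{1..I}. 0 \<le> \<mu> i)}"

text \<open>The entropy convention \<open>0 log 0 = 0\<close> holds automatically for the product \<open>\<mu> i * ln (\<mu> i)\<close>.\<close>

definition micp_objective ::
  "nat \<Rightarrow> (nat \<Rightarrow> real set) \<Rightarrow> (nat \<Rightarrow> real) \<Rightarrow> (nat \<Rightarrow> real) \<Rightarrow> (nat \<Rightarrow> nat \<Rightarrow> real) \<Rightarrow>
   ((nat \<Rightarrow> real) \<times> (nat \<Rightarrow> nat \<Rightarrow> real \<Rightarrow> real) \<times> (nat \<Rightarrow> real \<Rightarrow> real)) \<Rightarrow> real" where
  "micp_objective I P \<alpha> \<beta> \<gamma> = (\<lambda>(\<mu>, w, x).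
     (\<Sum>i\<in>{1..I}. \<mu> i * \<alpha> i)
     + (\<Sum>i\<in>{1..I}. \<Sum>t\<in>P i. ln t * w i i t)
     - (\<Sum>i\<in>{1..I}. \<beta> i * (\<Sum>t\<in>P i. ln t * w i i t))
     + (\<Sum>i\<in>{1..I}. \<Sum>j\<in>{1..I} - {i}. \<gamma> i j * (\<Sum>t\<in>P j. ln t * w i j t))
     - (\<Sum>i\<in>{1..I}. \<mu> i * ln (\<mu> i)))"

end

theory Submission
  imports Defs
begin

text \<open>
  The revenue is a sum of exponentials \<open>\<Sum>i. exp (e i)\<close>, so by the Gibbs variational principle
  its logarithm is the maximum of \<open>\<Sum>i. \<mu> i * e i - \<mu> i * ln (\<mu> i)\<close> over the probability simplex,
  attained at the softmax weights. A binary \<open>x\<close> selects one price \<open>p j\<close> for each product, and the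
  linking constraints then force \<open>w i j t\<close> to be \<open>\<mu> i\<close> for \<open>t = p j\<close> and \<open>0\<close> otherwise. Hence the
  objective of the program is exactly the Gibbs functional of \<open>\<mu>\<close> at the price vector \<open>p\<close>.
\<close>

text \<open>This is nonnegativity of the Kullback-Leibler divergence of \<open>\<mu>\<close> from
  the softmax weights \<open>exp (e i) / S\<close>. It follows termwise from
  \<open>ln y \<le> y - 1\<close>.\<close>

lemma Gibbs_variational_le:
  fixes \<mu> e :: "'a \<Rightarrow> real"
  assumes "finite A" and \<mu>_nonneg: "\<And>i. i \<in> A \<Longrightarrow> 0 \<le> \<mu> i" and \<mu>_sum: "sum \<mu> A = 1"
  shows "(\<Sum>i\<in>A. \<mu> i * e i) - (\<Sum>i\<in>A. \<mu> i * ln (\<mu> i)) \<le> ln (\<Sum>i\<in>A. exp (e i))"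
proof -
  define S where "S = (\<Sum>i\<in>A. exp (e i))"
  have "A \<noteq> {}"
    using \<mu>_sum by auto
  then have S_pos: "0 < S"
    unfolding S_def using \<open>finite A\<close> by (intro sum_pos) auto
  have term_le: "\<mu> i * e i - \<mu> i * ln (\<mu> i) - \<mu> i * ln S \<le> exp (e i) / S - \<mu> i" if "i \<in> A" for i
  \<comment> \<open>The ratio used below has \<open>\<mu> i\<close> in its denominator. At
    \<open>\<mu> i = 0\<close> the left side is \<open>0\<close> and the right side is
    positive.\<close>
  proof (cases "\<mu> i = 0")
    case True
    then show ?thesis
      using S_pos by simp
  next
    case False
    then have \<mu>_pos: "0 < \<mu> i"
      using \<mu>_nonneg[OF that] by simp
    \<comment> \<open>The argument of the logarithm is the softmax weight divided by
      \<open>\<mu> i\<close>.\<close>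
    have "e i - ln (\<mu> i) - ln S = ln (exp (e i) / (\<mu> i * S))"
      using \<mu>_pos S_pos by (simp add: ln_div ln_mult)
    also have "\<dots> \<le> exp (e i) / (\<mu> i * S) - 1"
      using \<mu>_pos S_pos by (intro ln_le_minus_one) simp
    finally have "\<mu> i * (e i - ln (\<mu> i) - ln S) \<le> \<mu> i * (exp (e i) / (\<mu> i * S) - 1)"
      using \<mu>_pos by (intro mult_left_mono) auto
    also have "\<dots> = exp (e i) / S - \<mu> i"
      using \<mu>_pos S_pos by (simp add: field_simps)
    finally show ?thesis
      by (simp add: algebra_simps)
  qed
  have "(\<Sum>i\<in>A. \<mu> i * e i) - (\<Sum>i\<in>A. \<mu> i * ln (\<mu> i)) - sum \<mu> A * ln S
      = (\<Sum>i\<in>A. \<mu> i * e i - \<mu> i * ln (\<mu> i) - \<mu> i * ln S)"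
    by (simp add: sum_subtractf sum_distrib_right)
  also have "\<dots> \<le> (\<Sum>i\<in>A. exp (e i) / S - \<mu> i)"
    by (intro sum_mono term_le)
  \<comment> \<open>Both the softmax weights and \<open>\<mu>\<close> have total mass 1, so this
    bound is 0.\<close>
  also have "\<dots> = S / S - sum \<mu> A"
    by (simp add: sum_subtractf S_def flip: sum_divide_distrib)
  finally show ?thesis
    using S_pos \<mu>_sum by (simp add: S_def)
qed

text \<open>For the softmax weights, \<open>e i - ln (\<mu> i)\<close> is the constant
  \<open>ln S\<close>, and averaging a constant against \<open>\<mu>\<close> returns it.\<close>

lemma Gibbs_variational_attained:
  fixes e :: "'a \<Rightarrow> real"
  assumes "finite A" and "A \<noteq> {}"
  obtains \<mu> where "\<And>i. 0 \<le> \<mu> i" and "sum \<mu> A = 1"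
    and "(\<Sum>i\<in>A. \<mu> i * e i) - (\<Sum>i\<in>A. \<mu> i * ln (\<mu> i)) = ln (\<Sum>i\<in>A. exp (e i))"
proof -
  define S where "S = (\<Sum>i\<in>A. exp (e i))"
  have S_pos: "0 < S"
    unfolding S_def using assms by (intro sum_pos) auto
  define \<mu> where "\<mu> i = exp (e i) / S" for i
  have \<mu>_sum: "sum \<mu> A = 1"
    using S_pos unfolding \<mu>_def by (simp add: S_def flip: sum_divide_distrib)
  have "(\<Sum>i\<in>A. \<mu> i * e i) - (\<Sum>i\<in>A. \<mu> i * ln (\<mu> i)) = (\<Sum>i\<in>A. \<mu> i * ln S)"
    unfolding sum_subtractf[symmetric]
    using S_pos by (intro sum.cong) (simp_all add: \<mu>_def ln_div field_simps)
  also have "\<dots> = ln S"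
    using \<mu>_sum by (simp flip: sum_distrib_right)
  finally show thesis
    using \<mu>_sum S_pos by (intro that[of \<mu>]) (auto simp: S_def \<mu>_def)
qed

text \<open>For positive prices this is the logarithm of the \<open>i\<close>-th summand of
  \<open>revenue\<close>; the extra \<open>ln (p i)\<close> absorbs the factor \<open>p i\<close>
  into the exponential.\<close>

definition log_revenue_term ::
  "nat \<Rightarrow> (nat \<Rightarrow> real) \<Rightarrow> (nat \<Rightarrow> real) \<Rightarrow> (nat \<Rightarrow> nat \<Rightarrow> real) \<Rightarrow> (nat \<Rightarrow> real) \<Rightarrow> nat \<Rightarrow> real" where
  "log_revenue_term I \<alpha> \<beta> \<gamma> p i =
     \<alpha> i + ln (p i) - \<beta> i * ln (p i) + (\<Sum>j\<in>{1..I} - {i}. \<gamma> i j * ln (p j))"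

lemma revenue_eq_sum_exp:
  assumes "\<And>i. i \<in> {1..I} \<Longrightarrow> 0 < p i"
  shows "revenue I \<alpha> \<beta> \<gamma> p = (\<Sum>i\<in>{1..I}. exp (log_revenue_term I \<alpha> \<beta> \<gamma> p i))"
  unfolding revenue_def log_revenue_term_def
  using assms by (intro sum.cong) (auto simp: exp_add exp_diff)

lemma sum_mult_concentrated:
  fixes f g :: "'a \<Rightarrow> real"
  assumes "finite A" and "a \<in> A" and "\<And>t. t \<in> A \<Longrightarrow> t \<noteq> a \<Longrightarrow> g t = 0"
  shows "(\<Sum>t\<in>A. f t * g t) = f a * g a"
proof -
  have "(\<Sum>t\<in>A. f t * g t) = (\<Sum>t\<in>{a}. f t * g t)"
    using assms by (intro sum.mono_neutral_right) auto
  then show ?thesis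
    by simp
qed

lemma binary_sum_one_concentrated:
  fixes x :: "'a \<Rightarrow> real"
  assumes "finite A" and x_binary: "\<And>t. t \<in> A \<Longrightarrow> x t \<in> {0, 1}" and x_sum: "sum x A = 1"
  obtains a where "a \<in> A" and "\<And>t. t \<in> A \<Longrightarrow> t \<noteq> a \<Longrightarrow> x t = 0"
proof -
  \<comment> \<open>If no value were 1, all would be 0 and the sum could not be 1.\<close>
  obtain a where a: "a \<in> A" "x a = 1"
    using x_sum x_binary by (metis insertE singletonD sum.neutral zero_neq_one)
  then have "sum x (A - {a}) = 0"
    using x_sum \<open>finite A\<close> by (simp add: sum_diff1)
  moreover have "0 \<le> x t" if "t \<in> A - {a}" for t
    using x_binary[of t] that by auto
  ultimately have "\<forall>t\<in>A - {a}. x t = 0"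
    using \<open>finite A\<close> by (subst (asm) sum_nonneg_eq_0_iff) auto
  with a show thesis
    by (intro that[of a]) auto
qed

text \<open>Shared by both inequalities: once each \<open>w i j\<close> puts its whole mass
  \<open>\<mu> i\<close> on \<open>p j\<close>, the objective becomes the Gibbs functional at
  \<open>p\<close>.\<close>

lemma micp_objective_concentrated:
  assumes fin: "\<And>j. j \<in> {1..I} \<Longrightarrow> finite (P j)" and mem: "\<And>j. j \<in> {1..I} \<Longrightarrow> p j \<in> P j"
    and w_other: "\<And>i j t. \<lbrakk>i \<in> {1..I}; j \<in> {1..I}; t \<in> P j; t \<noteq> p j\<rbrakk> \<Longrightarrow> w i j t = 0"
    and w_sum: "\<And>i j. \<lbrakk>i \<in> {1..I}; j \<in> {1..I}\<rbrakk> \<Longrightarrow> (\<Sum>t\<in>P j. w i j t) = \<mu> i"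
  shows "micp_objective I P \<alpha> \<beta> \<gamma> (\<mu>, w, x) =
    (\<Sum>i\<in>{1..I}. \<mu> i * log_revenue_term I \<alpha> \<beta> \<gamma> p i) - (\<Sum>i\<in>{1..I}. \<mu> i * ln (\<mu> i))"
proof -
  have mean: "(\<Sum>t\<in>P j. ln t * w i j t) = ln (p j) * \<mu> i" if "i \<in> {1..I}" "j \<in> {1..I}" for i j
  proof -
    have conc: "(\<Sum>t\<in>P j. f t * w i j t) = f (p j) * w i j (p j)" for f
      using that by (intro sum_mult_concentrated fin mem w_other) auto
    \<comment> \<open>The constant weight turns the row-sum constraint into the value of
      \<open>w\<close> at the selected price.\<close>
    from conc[of "\<lambda>_. 1"] have "w i j (p j) = \<mu> i"
      using w_sum[OF that] by simp
    then show ?thesis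
      using conc[of ln] by simp
  qed
  have own: "(\<Sum>i\<in>{1..I}. \<Sum>t\<in>P i. ln t * w i i t) = (\<Sum>i\<in>{1..I}. ln (p i) * \<mu> i)"
    "(\<Sum>i\<in>{1..I}. \<beta> i * (\<Sum>t\<in>P i. ln t * w i i t)) = (\<Sum>i\<in>{1..I}. \<beta> i * (ln (p i) * \<mu> i))"
    by (intro sum.cong refl; simp add: mean)+
  have cross: "(\<Sum>i\<in>{1..I}. \<Sum>j\<in>{1..I} - {i}. \<gamma> i j * (\<Sum>t\<in>P j. ln t * w i j t))
      = (\<Sum>i\<in>{1..I}. \<Sum>j\<in>{1..I} - {i}. \<gamma> i j * (ln (p j) * \<mu> i))"
    by (intro sum.cong refl) (simp add: mean)
  show ?thesis
    unfolding micp_objective_def prod.case own cross log_revenue_term_def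
    by (simp add: sum.distrib sum_subtractf sum_distrib_left algebra_simps)
qed

text \<open>The price vector is read off from the binary \<open>x\<close>; the Gibbs inequality then
  bounds the objective.\<close>

lemma micp_objective_le_log_revenue:
  assumes fin: "\<And>i. i \<in> {1..I} \<Longrightarrow> finite (P i)"
    and pos: "\<And>i t. i \<in> {1..I} \<Longrightarrow> t \<in> P i \<Longrightarrow> 0 < t"
    and "z \<in> micp_feasible I P"
  obtains p where "p \<in> price_vectors I P"
    and "micp_objective I P \<alpha> \<beta> \<gamma> z \<le> ln (revenue I \<alpha> \<beta> \<gamma> p)"
proof -
  obtain \<mu> w x where z: "z = (\<mu>, w, x)"
    by (cases z)
  have w_sum: "\<And>i j. \<lbrakk>i \<in> {1..I}; j \<in> {1..I}\<rbrakk> \<Longrightarrow> (\<Sum>t\<in>P j. w i j t) = \<mu> i"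
    and w_x: "\<And>j t. \<lbrakk>j \<in> {1..I}; t \<in> P j\<rbrakk> \<Longrightarrow> (\<Sum>i\<in>{1..I}. w i j t) = x j t"
    and \<mu>_sum: "(\<Sum>i\<in>{1..I}. \<mu> i) = 1"
    and x_sum: "\<And>i. i \<in> {1..I} \<Longrightarrow> (\<Sum>t\<in>P i. x i t) = 1"
    and w_nonneg: "\<And>i j t. \<lbrakk>i \<in> {1..I}; j \<in> {1..I}; t \<in> P j\<rbrakk> \<Longrightarrow> 0 \<le> w i j t"
    and x_binary: "\<And>i t. \<lbrakk>i \<in> {1..I}; t \<in> P i\<rbrakk> \<Longrightarrow> x i t \<in> {0, 1}"
    and \<mu>_nonneg: "\<And>i. i \<in> {1..I} \<Longrightarrow> 0 \<le> \<mu> i"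
    using \<open>z \<in> micp_feasible I P\<close> unfolding z micp_feasible_def by blast+
  have "\<exists>a\<in>P j. \<forall>t\<in>P j. t \<noteq> a \<longrightarrow> x j t = 0" if "j \<in> {1..I}" for j
    using binary_sum_one_concentrated[OF fin x_binary x_sum] that by metis
  then obtain q where q: "\<And>j. j \<in> {1..I} \<Longrightarrow> q j \<in> P j"
    "\<And>j t. \<lbrakk>j \<in> {1..I}; t \<in> P j; t \<noteq> q j\<rbrakk> \<Longrightarrow> x j t = 0"
    by metis
  \<comment> \<open>Membership in \<open>PiE\<close> requires the value \<open>undefined\<close>
    outside the index set.\<close>
  define p where "p = restrict q {1..I}"
  have p_mem: "p j \<in> P j" if "j \<in> {1..I}" for j
    using q(1) that by (simp add: p_def)
  have w_other: "w i j t = 0" if "i \<in> {1..I}" "j \<in> {1..I}" "t \<in> P j" "t \<noteq> p j" for i j t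
  proof -
    \<comment> \<open>At an unselected price the linking constraint makes a sum of nonnegative terms
      vanish, hence every term.\<close>
    have "(\<Sum>i\<in>{1..I}. w i j t) = 0"
      using w_x q(2) that by (simp add: p_def)
    moreover have "\<And>i. i \<in> {1..I} \<Longrightarrow> 0 \<le> w i j t"
      using w_nonneg that by blast
    ultimately show ?thesis
      using that(1) by (subst (asm) sum_nonneg_eq_0_iff) auto
  qed
  have "micp_objective I P \<alpha> \<beta> \<gamma> z =
      (\<Sum>i\<in>{1..I}. \<mu> i * log_revenue_term I \<alpha> \<beta> \<gamma> p i) - (\<Sum>i\<in>{1..I}. \<mu> i * ln (\<mu> i))"
    unfolding z by (intro micp_objective_concentrated fin p_mem w_other w_sum)
  also have "\<dots> \<le> ln (\<Sum>i\<in>{1..I}. exp (log_revenue_term I \<alpha> \<beta> \<gamma> p i))"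
    by (intro Gibbs_variational_le \<mu>_nonneg \<mu>_sum) auto
  also have "\<dots> = ln (revenue I \<alpha> \<beta> \<gamma> p)"
    using pos p_mem by (subst revenue_eq_sum_exp) auto
  finally have "micp_objective I P \<alpha> \<beta> \<gamma> z \<le> ln (revenue I \<alpha> \<beta> \<gamma> p)" .
  moreover have "p \<in> price_vectors I P"
    using q(1) by (auto simp: price_vectors_def p_def)
  ultimately show thesis
    using that by blast
qed

text \<open>The feasible point combines the softmax weights of the log revenue terms with the
  indicator of the prices in \<open>p\<close>.\<close>

lemma log_revenue_eq_micp_objective:
  assumes "0 < I"
    and fin: "\<And>i. i \<in> {1..I} \<Longrightarrow> finite (P i)"
    and pos: "\<And>i t. i \<in> {1..I} \<Longrightarrow> t \<in> P i \<Longrightarrow> 0 < t"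
    and "p \<in> price_vectors I P"
  obtains z where "z \<in> micp_feasible I P"
    and "micp_objective I P \<alpha> \<beta> \<gamma> z = ln (revenue I \<alpha> \<beta> \<gamma> p)"
proof -
  have p_mem: "p j \<in> P j" if "j \<in> {1..I}" for j
    using \<open>p \<in> price_vectors I P\<close> that by (auto simp: price_vectors_def)
  obtain \<mu> where \<mu>: "\<And>i. 0 \<le> \<mu> i" "sum \<mu> {1..I} = 1"
    "(\<Sum>i\<in>{1..I}. \<mu> i * log_revenue_term I \<alpha> \<beta> \<gamma> p i) - (\<Sum>i\<in>{1..I}. \<mu> i * ln (\<mu> i))
      = ln (\<Sum>i\<in>{1..I}. exp (log_revenue_term I \<alpha> \<beta> \<gamma> p i))"
    by (rule Gibbs_variational_attained[of "{1..I}" "log_revenue_term I \<alpha> \<beta> \<gamma> p"])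
      (use \<open>0 < I\<close> in auto)
  \<comment> \<open>This is \<open>\<mu> i\<close> times the point mass at \<open>p j\<close>.
    Summing over \<open>i\<close> gives \<open>x j t\<close>, because \<open>\<mu>\<close> sums to
    1.\<close>
  define w :: "nat \<Rightarrow> nat \<Rightarrow> real \<Rightarrow> real" where "w i j t = (if t = p j then \<mu> i else 0)" for i j t
  define x :: "nat \<Rightarrow> real \<Rightarrow> real" where "x j t = (if t = p j then 1 else 0)" for j t
  have w_sum: "(\<Sum>t\<in>P j. w i j t) = \<mu> i" if "j \<in> {1..I}" for i j
    using fin[OF that] p_mem[OF that] by (simp add: w_def)
  have "(\<mu>, w, x) \<in> micp_feasible I P"
    unfolding micp_feasible_def using fin p_mem \<mu> w_sum
    by (auto simp: w_def x_def)
  moreover have "micp_objective I P \<alpha> \<beta> \<gamma> (\<mu>, w, x) = ln (revenue I \<alpha> \<beta> \<gamma> p)"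
  proof -
    have "micp_objective I P \<alpha> \<beta> \<gamma> (\<mu>, w, x) =
        (\<Sum>i\<in>{1..I}. \<mu> i * log_revenue_term I \<alpha> \<beta> \<gamma> p i) - (\<Sum>i\<in>{1..I}. \<mu> i * ln (\<mu> i))"
      by (intro micp_objective_concentrated fin p_mem w_sum) (auto simp: w_def)
    also have "\<dots> = ln (revenue I \<alpha> \<beta> \<gamma> p)"
      unfolding \<mu>(3) using pos p_mem by (subst revenue_eq_sum_exp) auto
    finally show ?thesis .
  qed
  ultimately show thesis
    using that by blast
qed

text \<open>Suprema in \<open>ereal\<close> also cover an empty \<open>P i\<close>: then both index
  sets are empty and both sides are minus infinity. Excluding price 0 keeps every logarithm of a
  price at a positive argument.\<close>

theorem mainTheorem9:
  fixes I :: nat and P :: "nat \<Rightarrow> real set"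
    and \<alpha> \<beta> :: "nat \<Rightarrow> real" and \<gamma> :: "nat \<Rightarrow> nat \<Rightarrow> real"
  assumes "0 < I"
    and "\<And>i. i \<in> {1..I} \<Longrightarrow> finite (P i)"
    and "\<And>i. i \<in> {1..I} \<Longrightarrow> P i \<subseteq> {0..}"
    and "\<And>i. i \<in> {1..I} \<Longrightarrow> 0 \<notin> P i"
  shows "(SUP p\<in>price_vectors I P. ereal (ln (revenue I \<alpha> \<beta> \<gamma> p))) =
           (SUP z\<in>micp_feasible I P. ereal (micp_objective I P \<alpha> \<beta> \<gamma> z))
       \<and> (price_vectors I P \<noteq> {} \<longrightarrow>
           (\<exists>z\<in>micp_feasible I P. micp_objective I P \<alpha> \<beta> \<gamma> z =
              Max ((\<lambda>p. ln (revenue I \<alpha> \<beta> \<gamma> p)) ` price_vectors I P)))"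
proof (intro conjI impI)
  have pos: "0 < t" if "i \<in> {1..I}" "t \<in> P i" for i t
    using assms(3,4)[OF that(1)] that(2) by (metis atLeast_iff less_eq_real_def subsetD)
  have attained: "\<exists>z\<in>micp_feasible I P. micp_objective I P \<alpha> \<beta> \<gamma> z = ln (revenue I \<alpha> \<beta> \<gamma> p)"
    if "p \<in> price_vectors I P" for p
    by (rule log_revenue_eq_micp_objective[OF assms(1,2) pos that]) auto
  have bounded: "\<exists>p\<in>price_vectors I P. micp_objective I P \<alpha> \<beta> \<gamma> z \<le> ln (revenue I \<alpha> \<beta> \<gamma> p)"
    if "z \<in> micp_feasible I P" for z
    by (rule micp_objective_le_log_revenue[OF assms(2) pos that]) auto
  show "(SUP p\<in>price_vectors I P. ereal (ln (revenue I \<alpha> \<beta> \<gamma> p))) =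
      (SUP z\<in>micp_feasible I P. ereal (micp_objective I P \<alpha> \<beta> \<gamma> z))"
  proof (rule antisym)
    show "(SUP p\<in>price_vectors I P. ereal (ln (revenue I \<alpha> \<beta> \<gamma> p))) \<le>
        (SUP z\<in>micp_feasible I P. ereal (micp_objective I P \<alpha> \<beta> \<gamma> z))"
      by (rule SUP_mono) (metis attained order_refl)
    show "(SUP z\<in>micp_feasible I P. ereal (micp_objective I P \<alpha> \<beta> \<gamma> z)) \<le>
        (SUP p\<in>price_vectors I P. ereal (ln (revenue I \<alpha> \<beta> \<gamma> p)))"
      by (rule SUP_mono) (metis bounded ereal_less_eq(3))
  qed
  assume "price_vectors I P \<noteq> {}"
  \<comment> \<open>Finiteness makes \<open>Max\<close> the value at some price vector, and
    \<open>attained\<close> carries that value to a feasible point.\<close>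
  moreover have "finite (price_vectors I P)"
    unfolding price_vectors_def using assms(2) by (intro finite_PiE) auto
  ultimately have "Max ((\<lambda>p. ln (revenue I \<alpha> \<beta> \<gamma> p)) ` price_vectors I P)
      \<in> (\<lambda>p. ln (revenue I \<alpha> \<beta> \<gamma> p)) ` price_vectors I P"
    by (intro Max_in) auto
  then show "\<exists>z\<in>micp_feasible I P. micp_objective I P \<alpha> \<beta> \<gamma> z =
      Max ((\<lambda>p. ln (revenue I \<alpha> \<beta> \<gamma> p)) ` price_vectors I P)"
    using attained by fastforce
qed

end
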